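(* Let $n\ge 1$, let $\pi:\mathbb{R}^{n+1}\to\mathbb{R}^n$, $(x^1,\dots,x^n,u)\mapsto (x^1,\dots,x^n)$, and consider the Lagrangian $\mathcal{L}_{\min\Sigma}=[L\,d\mathbf{x}]$ with $L=L_{\min\Sigma}=\sqrt{1+\sum_{k=1}^n u_{x^k}^2}$ and its Euler–Lagrange equation $\mathcal{E}_{\min\Sigma}=\{\mathbf{E}_u(\mathcal{L}_{\min\Sigma})=0\}$ (the $n$-dimensional minimal area surface equation $\sum_i D_i(u_{x^i}/L)=0$). Consider the sections $\varphi_1=1$, $\varphi_2^i=u_{x^i}$ ($1\le i\le n$), $\varphi_3^{ij}=x^j u_{x^i}-x^i u_{x^j}$ ($1\le i,j\le n$), and $\varphi_4=u-\sum_{k=1}^n x^k u_{x^k}$. (1) For $\varphi\in\{\varphi_1,\varphi_2^i,\varphi_3^{ij}\}$ one has $[\mathfrak{D}_{\varphi}(\mathcal{L}_{\min\Sigma})]=0$ on the whole jet space $J^\infty(\pi)$, i.e. these are Noether symmetries of $\mathcal{L}_{\min\Sigma}$; the corresponding conserved currents give the following continuity equations on $\mathcal{E}_{\min\Sigma}^\infty$, respectively: $$\sum_{i=1}^n \bar D_i(\partial L/\partial u_{x^i})=0,$$ $$\bar D_i\big(u_{x^i}\,\partial L/\partial u_{x^i}-L\big)+\sum_{j\ne i}\bar D_j\big(u_{x^i}\,\partial L/\partial u_{x^j}\big)=0,$$ $$\bar D_i\big(x^jL-\varphi_3^{ij}u_{x^i}/L\big)-\bar D_j\big(x^iL+\varphi_3^{ij}u_{x^j}/L\big)-\sum_{k\ne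 i,j}\bar D_k\big(\varphi_3^{ij}u_{x^k}/L\big)=0.$$ (2) The dilatation $\varphi_4$ preserves the Lagrangian on the equation: $[\mathfrak{D}_{\varphi_4}(\mathcal{L}_{\min\Sigma})]=n\,\mathcal{L}_{\min\Sigma}$ on $\mathcal{E}_{\min\Sigma}$, hence $\mathbf{E}_u(\mathfrak{D}_{\varphi_4}(\mathcal{L}_{\min\Sigma}))=n\,\mathbf{E}_u(\mathcal{L}_{\min\Sigma})=0$ on $\mathcal{E}_{\min\Sigma}$. Moreover, if $s^i$, $1\le i\le n$, are nonlocal variables with $s^i_{x^i}=L$, then the nonlocal continuity equation $$\sum_i \tilde D_i\Big(s^i-x^iL-\frac{u\,u_{x^i}}{\sqrt{1+\sum_j u_{x^j}^2}}+\frac{u_{x^i}\sum_j x^ju_{x^j}}{\sqrt{1+\sum_k u_{x^k}^2}}\Big)=0$$ holds (it is assigned to the symmetry $\varphi_4$).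
   Context: $J^\infty(\pi)$ is the infinite jet space of $\pi$ with coordinates $x^i,u,u_\sigma$ ($\sigma$ multi-indices); $D_i$ are total derivatives, $\bar D_i$ their restrictions to the infinite prolongation $\mathcal{E}_{\min\Sigma}^\infty$, and $\tilde D_i$ their extensions to the covering with nonlocal variables $s^i$ (with $\tilde D_i(s^i)=L$). For a section $\varphi$, $\mathfrak{D}_\varphi=\sum_\sigma D_\sigma(\varphi)\,\partial/\partial u_\sigma$ is the evolutionary vector field with generating section $\varphi$. For a horizontal $n$-form $L\,d\mathbf{x}$, $[\,\cdot\,]$ denotes its class modulo total divergences $d_h(\cdot)$ (the functional), where $d_h=\sum_i dx^i\otimes D_i$; $\mathbf{E}_u$ is the Euler–Lagrange operator. "On $\mathcal{E}_{\min\Sigma}$" means modulo the equation and its differential consequences. *)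

theory Defs
  imports "HOL-Analysis.Analysis"
begin

text \<open>The base is real^'n (n = CARD('n)), fibre coordinate u.
 A point of J^infinity(pi) is (x, w) where w l is the jet coordinate
 u_l for a list l of indices (w [] = u, w [i] = u_{x^i},
 w (i # l) = D_i applied to w l); genuine jets are symmetric (see symjet).
 A differential function is a function of (x, w) depending on finitely many w l.\<close>

type_synonym 'n dfun = "real^'n \<Rightarrow> ('n list \<Rightarrow> real) \<Rightarrow> real"

definition lists_le :: "nat \<Rightarrow> ('n::finite) list set" where
  "lists_le m = {l. length l \<le> m}"

definition symjet :: "(('n::finite) list \<Rightarrow> real) \<Rightarrow> bool" where
  "symjet w \<longleftrightarrow> (\<forall>l l'. mset l = mset l' \<longrightarrow> w l = w l')"

definition order_le :: "nat \<Rightarrow> ('n::finite) dfun \<Rightarrow> bool" where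
  "order_le m G \<longleftrightarrow> (\<forall>x w w'. (\<forall>l\<in>lists_le m. w l = w' l) \<longrightarrow> G x w = G x w')"

definition xpd :: "'n::finite \<Rightarrow> 'n dfun \<Rightarrow> 'n dfun" where
  "xpd i G x w = deriv (\<lambda>t. G (x + t *\<^sub>R axis i 1) w) 0"

definition wpd :: "('n::finite) list \<Rightarrow> 'n dfun \<Rightarrow> 'n dfun" where
  "wpd l G x w = deriv (\<lambda>t. G x (w(l := w l + t))) 0"

text \<open>Total derivative D_i of a differential function of order at most m.\<close>
definition totD :: "nat \<Rightarrow> 'n::finite \<Rightarrow> 'n dfun \<Rightarrow> 'n dfun" where
  "totD m i G x w = xpd i G x w + (\<Sum>l\<in>lists_le m. w (i # l) * wpd l G x w)"

fun totDs :: "nat \<Rightarrow> ('n::finite) list \<Rightarrow> 'n dfun \<Rightarrow> 'n dfun" where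
  "totDs m [] G = G"
| "totDs m (i # l) G = totD (m + length l) i (totDs m l G)"

text \<open>Evolutionary derivative D_phi(G), phi of order mphi, G of order m.\<close>
definition evder :: "nat \<Rightarrow> ('n::finite) dfun \<Rightarrow> nat \<Rightarrow> 'n dfun \<Rightarrow> 'n dfun" where
  "evder mphi phi m G x w = (\<Sum>l\<in>lists_le m. totDs mphi l phi x w * wpd l G x w)"

text \<open>Euler--Lagrange operator E_u of a differential function of order m.\<close>
definition EL :: "nat \<Rightarrow> ('n::finite) dfun \<Rightarrow> 'n dfun" where
  "EL m G x w = (\<Sum>l\<in>lists_le m. (-1) ^ length l * totDs m l (wpd l G) x w)"

datatype 'n pdir = PDx 'n | PDw "'n list"

fun pdapp :: "('n::finite) pdir list \<Rightarrow> 'n dfun \<Rightarrow> 'n dfun" where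
  "pdapp [] G = G"
| "pdapp (PDx i # ds) G = xpd i (pdapp ds G)"
| "pdapp (PDw l # ds) G = wpd l (pdapp ds G)"

definition dfun_smooth :: "('n::finite) dfun \<Rightarrow> bool" where
  "dfun_smooth G \<longleftrightarrow> (\<forall>ds x w.
     (\<forall>i. (\<lambda>t. pdapp ds G (x + t *\<^sub>R axis i 1) w) differentiable (at (0::real))) \<and>
     (\<forall>l. (\<lambda>t. pdapp ds G x (w(l := w l + t))) differentiable (at (0::real))))"

definition is_dfun :: "('n::finite) dfun \<Rightarrow> bool" where
  "is_dfun G \<longleftrightarrow> (\<exists>m. order_le m G) \<and> dfun_smooth G"

text \<open>F is a total divergence sum_k D_k(P^k) at all points of a set A of the jet space,
 i.e. [F d x] = 0 there.\<close>
definition total_div_on :: "(real^'n \<Rightarrow> ('n list \<Rightarrow> real) \<Rightarrow> bool) \<Rightarrow> ('n::finite) dfun \<Rightarrow> bool" where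
  "total_div_on A F \<longleftrightarrow> (\<exists>P m. (\<forall>k. is_dfun (P k) \<and> order_le m (P k)) \<and>
      (\<forall>x w. A x w \<longrightarrow> F x w = (\<Sum>k\<in>UNIV. totD m k (P k) x w)))"

definition Lmin :: "('n::finite) dfun" where
  "Lmin x w = sqrt (1 + (\<Sum>k\<in>UNIV. (w [k])\<^sup>2))"

definition phi1 :: "('n::finite) dfun" where "phi1 x w = 1"
definition phi2 :: "'n::finite \<Rightarrow> 'n dfun" where "phi2 i x w = w [i]"
definition phi3 :: "'n::finite \<Rightarrow> 'n \<Rightarrow> 'n dfun" where
  "phi3 i j x w = x $ j * w [i] - x $ i * w [j]"
definition phi4 :: "('n::finite) dfun" where
  "phi4 x w = w [] - (\<Sum>k\<in>UNIV. x $ k * w [k])"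

definition Jinf :: "real^'n \<Rightarrow> (('n::finite) list \<Rightarrow> real) \<Rightarrow> bool" where
  "Jinf x w \<longleftrightarrow> symjet w"

definition Einf :: "real^'n \<Rightarrow> (('n::finite) list \<Rightarrow> real) \<Rightarrow> bool" where
  "Einf x w \<longleftrightarrow> symjet w \<and> (\<forall>l. totDs 2 l (EL 1 Lmin) x w = 0)"

text \<open>Covering with nonlocal variables s^k: functions of (x, w, s);
 S i k = tilde D_i (s^k).\<close>
type_synonym 'n cdfun = "real^'n \<Rightarrow> ('n list \<Rightarrow> real) \<Rightarrow> ('n \<Rightarrow> real) \<Rightarrow> real"

definition tDc :: "nat \<Rightarrow> ('n::finite \<Rightarrow> 'n \<Rightarrow> 'n dfun) \<Rightarrow> 'n \<Rightarrow> 'n cdfun \<Rightarrow> 'n cdfun" where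
  "tDc m S i G x w s = totD m i (\<lambda>x' w'. G x' w' s) x w
      + (\<Sum>k\<in>UNIV. S i k x w * deriv (\<lambda>t. G x w (s(k := s k + t))) 0)"

end

theory Submission
  imports Defs
begin

text \<open>
  All differential functions that occur are elementary: built from the coordinates \<open>x\<^sup>i\<close>,
  \<open>u\<^sub>\<sigma>\<close> by field operations and square roots. Such functions are smooth and obey the Leibniz
  and chain rules for total derivatives, so every claim becomes a finite computation in the jet
  coordinates. Writing \<open>L\<^sub>k = u\<^sub>k / L\<close> for \<open>\<partial>L/\<partial>u\<^sub>k\<close>, one has
  \<open>D\<^sub>i L = \<Sum>\<^sub>k u\<^sub>i\<^sub>k L\<^sub>k\<close>, \<open>E\<^sub>u(L) = - \<Sum>\<^sub>k D\<^sub>k L\<^sub>k\<close> and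
  \<open>\<D>\<^sub>\<phi> L = \<Sum>\<^sub>k D\<^sub>k(\<phi>) L\<^sub>k\<close>. On symmetric jets this exhibits \<open>\<D>\<^sub>\<phi> L\<close> as a total
  divergence for \<open>\<phi>\<^sub>1, \<phi>\<^sub>2, \<phi>\<^sub>3\<close>, and \<open>\<D>\<^sub>\<phi>\<^sub>4 L = n L + \<Sum>\<^sub>k D\<^sub>k(-x\<^sup>k L)\<close>.
  The Leibniz identity \<open>\<Sum>\<^sub>k D\<^sub>k(f L\<^sub>k) = \<Sum>\<^sub>k D\<^sub>k(f) L\<^sub>k - f E\<^sub>u(L)\<close> shows that each
  continuity equation is, up to sign, its characteristic times \<open>E\<^sub>u(L)\<close>, hence vanishes on
  the equation. Finally \<open>E\<^sub>u(\<D>\<^sub>\<phi>\<^sub>4 L) = n E\<^sub>u(L)\<close> by direct computation: the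
  contributions of the first and second order partial derivatives of \<open>\<D>\<^sub>\<phi>\<^sub>4 L\<close> cancel
  pairwise by the symmetry of the jets and of the Hessian of \<open>L\<close>, up to \<open>n\<close> copies of
  \<open>- \<Sum>\<^sub>a D\<^sub>a L\<^sub>a\<close>.
\<close>

text \<open>
  Otherwise \<open>simp\<close> turns the order \<open>1\<close> into \<open>Suc 0\<close>, and lemmas about
  \<^term>\<open>totD 1\<close> or \<^term>\<open>EL 1\<close> stop matching the statement.
\<close>
declare One_nat_def [simp del]

section \<open>Directional derivatives of elementary differential functions\<close>

definition dirderiv :: "real^'n \<Rightarrow> ('n list \<Rightarrow> real) \<Rightarrow> ('n::finite) dfun \<Rightarrow> 'n dfun" where
  "dirderiv v d G x w = deriv (\<lambda>t. G (x + t *\<^sub>R v) (\<lambda>l. w l + t * d l)) 0"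

text \<open>
  \<^const>\<open>dfun_smooth\<close> asks for partial derivatives of all orders; they come from the closure
  of this syntactic class under directional derivatives.
\<close>
inductive elementary :: "('n::finite) dfun \<Rightarrow> bool" where
  elementary_const: "elementary (\<lambda>x w. c)"
| elementary_coord: "elementary (\<lambda>x w. x $ j)"
| elementary_jet: "elementary (\<lambda>x w. w l)"
| elementary_add: "elementary f \<Longrightarrow> elementary g \<Longrightarrow> elementary (\<lambda>x w. f x w + g x w)"
| elementary_mult: "elementary f \<Longrightarrow> elementary g \<Longrightarrow> elementary (\<lambda>x w. f x w * g x w)"
| elementary_inverse: "elementary f \<Longrightarrow> (\<And>x w. f x w \<noteq> 0) \<Longrightarrow> elementary (\<lambda>x w. inverse (f x w))"
| elementary_sqrt: "elementary f \<Longrightarrow> (\<And>x w. f x w > 0) \<Longrightarrow> elementary (\<lambda>x w. sqrt (f x w))"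

lemma dirderiv_eqI:
  "((\<lambda>t. G (x + t *\<^sub>R v) (\<lambda>l. w l + t * d l)) has_real_derivative D) (at 0) \<Longrightarrow> dirderiv v d G x w = D"
  unfolding dirderiv_def by (rule DERIV_imp_deriv)

lemma elementary_dirderiv_has_derivative:
  assumes "elementary f"
  shows "elementary (dirderiv v d f) \<and>
    (\<forall>x w. ((\<lambda>t. f (x + t *\<^sub>R v) (\<lambda>l. w l + t * d l)) has_real_derivative dirderiv v d f x w) (at 0))"
  using assms
proof induction
  have by_derivative: "elementary (dirderiv v d g) \<and>
      (\<forall>x w. ((\<lambda>t. g (x + t *\<^sub>R v) (\<lambda>l. w l + t * d l)) has_real_derivative dirderiv v d g x w) (at 0))"
    if "\<And>x w. ((\<lambda>t. g (x + t *\<^sub>R v) (\<lambda>l. w l + t * d l)) has_real_derivative D x w) (at 0)"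
      and "elementary D" for g D
  proof -
    have "dirderiv v d g = D" using dirderiv_eqI[OF that(1)] by (intro ext)
    with that show ?thesis by simp
  qed
  {
    case (elementary_const c)
    show ?case by (rule by_derivative[of _ "\<lambda>x w. 0"]) (auto intro: elementary.intros)
  next
    case (elementary_coord j)
    show ?case by (rule by_derivative[of _ "\<lambda>x w. v $ j"]) (auto intro!: derivative_eq_intros elementary.intros)
  next
    case (elementary_jet l)
    show ?case by (rule by_derivative[of _ "\<lambda>x w. d l"]) (auto intro!: derivative_eq_intros elementary.intros)
  next
    case (elementary_add f g)
    then show ?case
      by (intro by_derivative[of _ "\<lambda>x w. dirderiv v d f x w + dirderiv v d g x w"]) (auto intro!: derivative_eq_intros elementary.intros)
  next
    case (elementary_mult f g)
    then show ?case
      by (intro by_derivative[of _ "\<lambda>x w. dirderiv v d f x w * g x w + f x w * dirderiv v d g x w"])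
        (auto intro!: derivative_eq_intros elementary.intros)
  next
    case (elementary_inverse f)
    show ?case
    proof (rule by_derivative)
      show "elementary (\<lambda>x w. (-1) * (dirderiv v d f x w * (inverse (f x w) * inverse (f x w))))"
        using elementary_inverse by (intro elementary.intros) auto
    qed (use elementary_inverse in \<open>auto intro!: derivative_eq_intros simp: field_simps\<close>)
  next
    case (elementary_sqrt f)
    have pos: "f x w \<noteq> 0" "\<not> f x w < 0" for x w
      using elementary_sqrt.hyps(2)[of x w] by simp_all
    show ?case
    proof (rule by_derivative)
      show "elementary (\<lambda>x w. dirderiv v d f x w * ((1/2) * inverse (sqrt (f x w))))"
        using elementary_sqrt by (intro elementary.intros) (auto simp: pos)
    qed (use elementary_sqrt pos in \<open>auto intro!: derivative_eq_intros simp: field_simps\<close>)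
  }
qed

lemma has_dirderiv_elementary:
  "elementary f \<Longrightarrow>
    ((\<lambda>t. f (x + t *\<^sub>R v) (\<lambda>l. w l + t * d l)) has_real_derivative dirderiv v d f x w) (at 0)"
  using elementary_dirderiv_has_derivative by blast

lemma elementary_dirderiv: "elementary f \<Longrightarrow> elementary (dirderiv v d f)"
  using elementary_dirderiv_has_derivative by blast

lemma xpd_eq_dirderiv: "xpd i G = dirderiv (axis i 1) (\<lambda>_. 0) G"
  by (intro ext) (simp add: xpd_def dirderiv_def)

lemma jet_update_eq: "w(l := w l + t) = (\<lambda>l'. w l' + t * of_bool (l' = l))" for w :: "'a \<Rightarrow> real"
  by (auto simp: fun_eq_iff)

lemma wpd_eq_dirderiv: "wpd l G = dirderiv 0 (\<lambda>l'. of_bool (l' = l)) G"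
  by (intro ext) (simp add: wpd_def dirderiv_def jet_update_eq)

lemma elementary_pdapp: "elementary G \<Longrightarrow> elementary (pdapp ds G)"
  by (induction ds G rule: pdapp.induct)
    (simp_all add: xpd_eq_dirderiv wpd_eq_dirderiv elementary_dirderiv)

lemma elementary_imp_smooth: "elementary G \<Longrightarrow> dfun_smooth G"
  unfolding dfun_smooth_def
proof (intro allI conjI)
  fix ds x w i l
  assume "elementary G"
  then have G': "elementary (pdapp ds G)" by (rule elementary_pdapp)
  show "(\<lambda>t. pdapp ds G (x + t *\<^sub>R axis i 1) w) differentiable (at 0)"
    using has_dirderiv_elementary[OF G', of x "axis i 1" w "\<lambda>_. 0"]
    by (auto simp: real_differentiable_def)
  show "(\<lambda>t. pdapp ds G x (w(l := w l + t))) differentiable (at 0)"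
    using has_dirderiv_elementary[OF G', of x 0 w "\<lambda>l'. of_bool (l' = l)"]
    by (auto simp: real_differentiable_def jet_update_eq)
qed

lemma elementary_minus: "elementary f \<Longrightarrow> elementary (\<lambda>x w. - f x w)"
  using elementary_mult[OF elementary_const[of "-1"]] by simp

lemma elementary_diff: "elementary f \<Longrightarrow> elementary g \<Longrightarrow> elementary (\<lambda>x w. f x w - g x w)"
  using elementary_add[OF _ elementary_minus[of g]] by simp

lemma elementary_sum:
  "finite A \<Longrightarrow> (\<And>k. k \<in> A \<Longrightarrow> elementary (f k)) \<Longrightarrow> elementary (\<lambda>x w. \<Sum>k\<in>A. f k x w)"
  by (induction A rule: finite_induct) (auto intro: elementary.intros)

lemma elementary_power: "elementary f \<Longrightarrow> elementary (\<lambda>x w. f x w ^ n)"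
  by (induction n) (auto intro: elementary.intros)

lemma elementary_divide:
  "elementary f \<Longrightarrow> elementary g \<Longrightarrow> (\<And>x w. g x w \<noteq> 0) \<Longrightarrow> elementary (\<lambda>x w. f x w / g x w)"
  unfolding divide_inverse by (intro elementary.intros)

lemmas elementary_intros =
  elementary.intros elementary_minus elementary_diff elementary_sum elementary_power

lemma dirderiv_const [simp]: "dirderiv v d (\<lambda>x w. c) x w = 0"
  by (simp add: dirderiv_def)

lemma dirderiv_coord [simp]: "dirderiv v d (\<lambda>x w. x $ j) x w = v $ j"
  by (rule dirderiv_eqI) (auto intro!: derivative_eq_intros)

lemma dirderiv_jet [simp]: "dirderiv v d (\<lambda>x w. w l) x w = d l"
  by (rule dirderiv_eqI) (auto intro!: derivative_eq_intros)

lemma dirderiv_add: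
  "elementary f \<Longrightarrow> elementary g \<Longrightarrow>
    dirderiv v d (\<lambda>x w. f x w + g x w) x w = dirderiv v d f x w + dirderiv v d g x w"
  by (rule dirderiv_eqI) (intro DERIV_add has_dirderiv_elementary)

lemma dirderiv_minus: "elementary f \<Longrightarrow> dirderiv v d (\<lambda>x w. - f x w) x w = - dirderiv v d f x w"
  by (rule dirderiv_eqI) (intro DERIV_minus has_dirderiv_elementary)

lemma dirderiv_diff:
  "elementary f \<Longrightarrow> elementary g \<Longrightarrow>
    dirderiv v d (\<lambda>x w. f x w - g x w) x w = dirderiv v d f x w - dirderiv v d g x w"
  by (rule dirderiv_eqI) (intro DERIV_diff has_dirderiv_elementary)

lemma dirderiv_mult:
  "elementary f \<Longrightarrow> elementary g \<Longrightarrow>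
    dirderiv v d (\<lambda>x w. f x w * g x w) x w = dirderiv v d f x w * g x w + f x w * dirderiv v d g x w"
  by (rule dirderiv_eqI) (auto intro!: derivative_eq_intros has_dirderiv_elementary)

lemma dirderiv_sum:
  "finite A \<Longrightarrow> (\<And>k. k \<in> A \<Longrightarrow> elementary (f k)) \<Longrightarrow>
    dirderiv v d (\<lambda>x w. \<Sum>k\<in>A. f k x w) x w = (\<Sum>k\<in>A. dirderiv v d (f k) x w)"
  by (rule dirderiv_eqI) (intro DERIV_sum has_dirderiv_elementary)

lemma dirderiv_power:
  "elementary f \<Longrightarrow> dirderiv v d (\<lambda>x w. f x w ^ n) x w = of_nat n * f x w ^ (n - 1) * dirderiv v d f x w"
  by (rule dirderiv_eqI) (auto intro!: derivative_eq_intros has_dirderiv_elementary simp: One_nat_def)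

lemma dirderiv_divide:
  "elementary f \<Longrightarrow> elementary g \<Longrightarrow> g x w \<noteq> 0 \<Longrightarrow>
    dirderiv v d (\<lambda>x w. f x w / g x w) x w
      = (dirderiv v d f x w * g x w - f x w * dirderiv v d g x w) / (g x w)\<^sup>2"
  by (rule dirderiv_eqI) (auto intro!: derivative_eq_intros has_dirderiv_elementary simp: field_simps power2_eq_square)

lemma dirderiv_sqrt:
  "elementary f \<Longrightarrow> f x w > 0 \<Longrightarrow>
    dirderiv v d (\<lambda>x w. sqrt (f x w)) x w = dirderiv v d f x w / (2 * sqrt (f x w))"
  by (rule dirderiv_eqI) (auto intro!: derivative_eq_intros has_dirderiv_elementary simp: field_simps)

section \<open>Total derivatives\<close>

lemma mem_lists_le [simp]: "l \<in> lists_le m \<longleftrightarrow> length l \<le> m"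
  by (simp add: lists_le_def)

lemma finite_lists_le [simp]: "finite (lists_le m :: ('n::finite) list set)"
  using finite_lists_length_le[of "UNIV :: 'n set" m] by (simp add: lists_le_def)

lemma lists_le_Suc: "lists_le (Suc m) = insert [] ((\<lambda>(k, l). k # l) ` (UNIV \<times> lists_le m))"
  unfolding lists_le_def
proof (intro set_eqI iffI)
  fix l :: "'a list"
  assume "l \<in> {l. length l \<le> Suc m}"
  then show "l \<in> insert [] ((\<lambda>(k, l). k # l) ` (UNIV \<times> {l. length l \<le> m}))"
    by (cases l) auto
qed auto

lemma sum_lists_le_Suc:
  fixes f :: "('n::finite) list \<Rightarrow> 'a::comm_monoid_add"
  shows "(\<Sum>l\<in>lists_le (Suc m). f l) = f [] + (\<Sum>k\<in>UNIV. \<Sum>l\<in>lists_le m. f (k # l))"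
proof -
  let ?cons = "\<lambda>(k, l). k # l" and ?P = "UNIV \<times> lists_le m :: ('n \<times> 'n list) set"
  have "finite ?P"
    using finite_lists_length_le[of "UNIV :: 'n set" m] by (simp add: lists_le_def)
  then have "(\<Sum>l\<in>lists_le (Suc m). f l) = f [] + sum f (?cons ` ?P)"
    unfolding lists_le_Suc by (subst sum.insert) auto
  also have "sum f (?cons ` ?P) = (\<Sum>(k, l)\<in>?P. f (k # l))"
    by (subst sum.reindex) (auto simp: inj_on_def split_def)
  finally show ?thesis
    by (simp add: sum.cartesian_product)
qed

lemma sum_lists_le_1:
  "(\<Sum>l\<in>lists_le 1. f l) = f [] + (\<Sum>k\<in>UNIV. f [k :: 'n::finite])"
  using sum_lists_le_Suc[of f 0] by (simp add: lists_le_def One_nat_def)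

lemma sum_lists_le_2:
  "(\<Sum>l\<in>lists_le 2. f l) = f [] + (\<Sum>k\<in>UNIV. f [k :: 'n::finite]) + (\<Sum>a\<in>UNIV. \<Sum>b\<in>UNIV. f [a, b])"
proof -
  have "(\<Sum>l\<in>lists_le 2. f l) = (\<Sum>l\<in>lists_le (Suc 1). f l)"
    by (simp add: numeral_2_eq_2 One_nat_def)
  also have "\<dots> = f [] + (\<Sum>k\<in>UNIV. f [k] + (\<Sum>b\<in>UNIV. f [k, b]))"
    unfolding sum_lists_le_Suc sum_lists_le_1 by simp
  finally show ?thesis
    by (simp add: sum.distrib add.assoc)
qed

lemma sum_remove2:
  assumes "finite A" and "i \<in> A" and "j \<in> A" and "i \<noteq> j"
  shows "sum f A = f i + f j + sum f (A - {i, j})"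
proof -
  have "sum f A = f i + sum f (A - {i})"
    using assms by (simp add: sum.remove)
  also have "sum f (A - {i}) = f j + sum f (A - {i} - {j})"
    using assms by (simp add: sum.remove)
  finally show ?thesis
    by (simp add: Diff_insert2[symmetric] add.assoc)
qed

lemma totD_eq_dirderiv:
  "totD m i G x w = dirderiv (axis i 1) (\<lambda>_. 0) G x w
     + (\<Sum>l\<in>lists_le m. w (i # l) * dirderiv 0 (\<lambda>l'. of_bool (l' = l)) G x w)"
  by (simp add: totD_def xpd_eq_dirderiv wpd_eq_dirderiv)

lemma totD_const [simp]: "totD m i (\<lambda>x w. c) x w = 0"
  by (simp add: totD_eq_dirderiv)

lemma totD_coord [simp]: "totD m i (\<lambda>x w. x $ j) x w = of_bool (i = j)"
  by (simp add: totD_eq_dirderiv axis_def)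

lemma totD_jet [simp]: "totD m i (\<lambda>x w. w l) x w = (if length l \<le> m then w (i # l) else 0)"
proof -
  have "(\<Sum>l'\<in>lists_le m. w (i # l') * of_bool (l = l')) = (\<Sum>l'\<in>lists_le m. if l = l' then w (i # l) else 0)"
    by (rule sum.cong) auto
  then show ?thesis
    by (simp add: totD_eq_dirderiv)
qed

lemma totD_add:
  "elementary f \<Longrightarrow> elementary g \<Longrightarrow>
    totD m i (\<lambda>x w. f x w + g x w) x w = totD m i f x w + totD m i g x w"
  by (simp add: totD_eq_dirderiv dirderiv_add algebra_simps sum.distrib)

lemma totD_diff:
  "elementary f \<Longrightarrow> elementary g \<Longrightarrow>
    totD m i (\<lambda>x w. f x w - g x w) x w = totD m i f x w - totD m i g x w"
  by (simp add: totD_eq_dirderiv dirderiv_diff algebra_simps sum_subtractf)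

lemma totD_minus: "elementary f \<Longrightarrow> totD m i (\<lambda>x w. - f x w) x w = - totD m i f x w"
  by (simp add: totD_eq_dirderiv dirderiv_minus sum_negf)

lemma totD_mult:
  "elementary f \<Longrightarrow> elementary g \<Longrightarrow>
    totD m i (\<lambda>x w. f x w * g x w) x w = totD m i f x w * g x w + f x w * totD m i g x w"
  by (simp add: totD_eq_dirderiv dirderiv_mult algebra_simps sum.distrib sum_distrib_left sum_distrib_right)

lemma totD_sum:
  "finite A \<Longrightarrow> (\<And>k. k \<in> A \<Longrightarrow> elementary (f k)) \<Longrightarrow>
    totD m i (\<lambda>x w. \<Sum>k\<in>A. f k x w) x w = (\<Sum>k\<in>A. totD m i (f k) x w)"
  by (simp add: totD_eq_dirderiv dirderiv_sum sum.distrib sum_distrib_left sum.swap[of _ A])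

lemmas totD_rules = totD_add totD_diff totD_minus totD_mult totD_sum

lemma totD_order_le:
  assumes "order_le m G" and "m \<le> m'"
  shows "totD m' i G x w = totD m i G x w"
proof -
  have "wpd l G x w = 0" if "l \<in> lists_le m' - lists_le m" for l
  proof -
    have "G x (w(l := w l + t)) = G x w" for t
      using assms(1) that unfolding order_le_def by (metis fun_upd_other DiffD2)
    then show ?thesis by (simp add: wpd_def)
  qed
  moreover have "lists_le m \<subseteq> lists_le m'"
    using assms(2) by (auto simp: lists_le_def)
  ultimately show ?thesis
    unfolding totD_def by (auto intro!: sum.mono_neutral_right)
qed

lemma symjet_swap: "symjet w \<Longrightarrow> w [a, b] = w [b, a]"
  unfolding symjet_def by (simp add: add_mset_commute)

lemma symjet_swap_head: "symjet w \<Longrightarrow> w [a, b, c] = w [b, a, c]"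
  unfolding symjet_def by (simp add: add_mset_commute)

lemma symjet_swap_tail: "symjet w \<Longrightarrow> w [a, b, c] = w [a, c, b]"
  unfolding symjet_def by (simp add: add_mset_commute)

section \<open>The minimal-surface Lagrangian\<close>

lemma Lmin_pos [simp]: "Lmin x w > 0"
  by (simp add: Lmin_def add_pos_nonneg sum_nonneg)

lemma Lmin_nonzero [simp]: "Lmin x w \<noteq> 0"
  using Lmin_pos[of x w] by linarith

lemma elementary_Lmin: "elementary Lmin"
  unfolding Lmin_def[abs_def]
  by (intro elementary_intros) (auto simp: add_pos_nonneg sum_nonneg)

lemma order_le_Lmin: "order_le 1 Lmin"
  unfolding order_le_def Lmin_def by simp

lemma xpd_Lmin: "xpd i Lmin x w = 0"
  by (simp add: xpd_def Lmin_def)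

lemma dirderiv_Lmin: "dirderiv v d Lmin x w = (\<Sum>k\<in>UNIV. w [k] * d [k]) / Lmin x w"
proof -
  let ?Q = "\<lambda>(x::real^'a) w. 1 + (\<Sum>k\<in>UNIV. (w [k])\<^sup>2)"
  have Q: "elementary ?Q"
    by (intro elementary_intros) auto
  have "dirderiv v d Lmin x w = dirderiv v d ?Q x w / (2 * Lmin x w)"
    using dirderiv_sqrt[OF Q] unfolding Lmin_def[abs_def] by (simp add: add_pos_nonneg sum_nonneg)
  also have "dirderiv v d ?Q x w = (\<Sum>k\<in>UNIV. 2 * w [k] * d [k])"
    by (simp add: dirderiv_add dirderiv_sum dirderiv_power elementary_intros)
  finally show ?thesis
    by (simp add: sum_distrib_left[symmetric] mult.assoc)
qed

definition grad_Lmin :: "'n::finite \<Rightarrow> 'n dfun" where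
  "grad_Lmin k x w = w [k] / Lmin x w"

definition hess_Lmin :: "'n::finite \<Rightarrow> 'n \<Rightarrow> 'n dfun" where
  "hess_Lmin a c x w = of_bool (a = c) / Lmin x w - w [a] * w [c] / Lmin x w ^ 3"

lemma wpd_Lmin_Nil: "wpd [] Lmin = (\<lambda>x w. 0)"
  by (intro ext) (simp add: wpd_eq_dirderiv dirderiv_Lmin)

lemma wpd_Lmin_single: "wpd [k] Lmin = grad_Lmin k"
  by (intro ext) (simp add: wpd_eq_dirderiv dirderiv_Lmin grad_Lmin_def)

lemma totD_Lmin:
  assumes "1 \<le> m"
  shows "totD m i Lmin x w = (\<Sum>k\<in>UNIV. w [i, k] * grad_Lmin k x w)"
proof -
  have "totD m i Lmin x w = totD 1 i Lmin x w"
    using totD_order_le[OF order_le_Lmin assms] .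
  also have "\<dots> = (\<Sum>k\<in>UNIV. w [i, k] * grad_Lmin k x w)"
    by (simp add: totD_def sum_lists_le_1 xpd_Lmin wpd_Lmin_Nil wpd_Lmin_single)
  finally show ?thesis .
qed

lemma elementary_grad_Lmin: "elementary (grad_Lmin k)"
  unfolding grad_Lmin_def[abs_def] by (intro elementary_divide elementary_intros elementary_Lmin) simp

lemma order_le_grad_Lmin: "order_le 1 (grad_Lmin k)"
  unfolding order_le_def grad_Lmin_def Lmin_def by simp

lemma xpd_grad_Lmin: "xpd i (grad_Lmin k) x w = 0"
  by (simp add: xpd_def grad_Lmin_def Lmin_def)

lemma dirderiv_grad_Lmin: "dirderiv v d (grad_Lmin a) x w = (\<Sum>c\<in>UNIV. d [c] * hess_Lmin a c x w)"
proof -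
  have "dirderiv v d (grad_Lmin a) x w
      = (d [a] * Lmin x w - w [a] * dirderiv v d Lmin x w) / (Lmin x w)\<^sup>2"
    unfolding grad_Lmin_def[abs_def]
    by (simp add: dirderiv_divide elementary_Lmin elementary_intros)
  also have "\<dots> = d [a] / Lmin x w - w [a] * (\<Sum>c\<in>UNIV. w [c] * d [c]) / Lmin x w ^ 3"
    by (simp add: dirderiv_Lmin field_simps power2_eq_square power3_eq_cube)
  also have "\<dots> = (\<Sum>c\<in>UNIV. d [c] * of_bool (c = a) / Lmin x w - w [a] * (w [c] * d [c]) / Lmin x w ^ 3)"
    by (simp add: sum_subtractf sum_distrib_left sum_divide_distrib[symmetric])
  also have "\<dots> = (\<Sum>c\<in>UNIV. d [c] * hess_Lmin a c x w)"
    by (rule sum.cong) (auto simp: hess_Lmin_def field_simps)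
  finally show ?thesis .
qed

lemma wpd_grad_Lmin_Nil: "wpd [] (grad_Lmin a) = (\<lambda>x w. 0)"
  by (intro ext) (simp add: wpd_eq_dirderiv dirderiv_grad_Lmin)

lemma wpd_grad_Lmin_single: "wpd [c] (grad_Lmin a) = hess_Lmin a c"
  by (intro ext) (simp add: wpd_eq_dirderiv dirderiv_grad_Lmin mult.commute)

lemma totD_grad_Lmin:
  assumes "1 \<le> m"
  shows "totD m b (grad_Lmin a) x w = (\<Sum>c\<in>UNIV. w [b, c] * hess_Lmin a c x w)"
proof -
  have "totD m b (grad_Lmin a) x w = totD 1 b (grad_Lmin a) x w"
    using totD_order_le[OF order_le_grad_Lmin assms] .
  also have "\<dots> = (\<Sum>c\<in>UNIV. w [b, c] * hess_Lmin a c x w)"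
    by (simp add: totD_def sum_lists_le_1 xpd_grad_Lmin wpd_grad_Lmin_Nil wpd_grad_Lmin_single)
  finally show ?thesis .
qed

lemma hess_Lmin_sym: "hess_Lmin a c = hess_Lmin c a"
  by (intro ext) (auto simp: hess_Lmin_def mult.commute)

lemma elementary_hess_Lmin: "elementary (hess_Lmin a c)"
  unfolding hess_Lmin_def[abs_def]
  by (intro elementary_diff elementary_divide elementary_intros elementary_Lmin) simp_all

lemma order_le_hess_Lmin: "order_le 1 (hess_Lmin a c)"
  unfolding order_le_def hess_Lmin_def Lmin_def by simp

lemma EL_Lmin: "EL 1 Lmin x w = - (\<Sum>k\<in>UNIV. totD 1 k (grad_Lmin k) x w)"
  by (simp add: EL_def sum_lists_le_1 wpd_Lmin_Nil wpd_Lmin_single sum_negf)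

lemma evder_Lmin: "evder m phi 1 Lmin x w = (\<Sum>k\<in>UNIV. totD m k phi x w * grad_Lmin k x w)"
  by (simp add: evder_def sum_lists_le_1 wpd_Lmin_Nil wpd_Lmin_single)

lemma sum_totD_mult_grad_Lmin:
  "elementary f \<Longrightarrow>
    (\<Sum>k\<in>UNIV. totD 1 k (\<lambda>x w. f x w * grad_Lmin k x w) x w)
      = (\<Sum>k\<in>UNIV. totD 1 k f x w * grad_Lmin k x w) - f x w * EL 1 Lmin x w"
  unfolding EL_Lmin by (simp add: totD_mult elementary_grad_Lmin sum.distrib sum_distrib_left)

section \<open>Noether symmetries\<close>

lemma total_div_onI:
  assumes "\<And>k. elementary (P k)" and "\<And>k. order_le m (P k)"
    and "\<And>x w. A x w \<Longrightarrow> F x w = (\<Sum>k\<in>UNIV. totD m k (P k) x w)"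
  shows "total_div_on A F"
  unfolding total_div_on_def is_dfun_def using assms elementary_imp_smooth by blast

lemma total_div_on_mono: "total_div_on A F \<Longrightarrow> (\<And>x w. B x w \<Longrightarrow> A x w) \<Longrightarrow> total_div_on B F"
  unfolding total_div_on_def by blast

lemma order_le_coord_mult_Lmin: "order_le 1 (\<lambda>x w. c x * Lmin x w)"
  unfolding order_le_def Lmin_def by simp

lemma elementary_phi3: "elementary (phi3 i j)"
  unfolding phi3_def[abs_def] by (intro elementary_intros)

lemma elementary_phi4: "elementary phi4"
  unfolding phi4_def[abs_def] by (intro elementary_intros) auto

lemma evder_phi1: "evder 0 phi1 1 Lmin x w = 0"
  by (simp add: evder_Lmin phi1_def[abs_def])

lemma evder_phi2: "symjet w \<Longrightarrow> evder 1 (phi2 i) 1 Lmin x w = totD 1 i Lmin x w"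
  by (simp add: evder_Lmin phi2_def[abs_def] totD_Lmin symjet_swap)

lemma evder_phi3:
  assumes "symjet w"
  shows "evder 1 (phi3 i j) 1 Lmin x w = x $ j * totD 1 i Lmin x w - x $ i * totD 1 j Lmin x w"
proof -
  have "evder 1 (phi3 i j) 1 Lmin x w
      = (w [i] * grad_Lmin j x w - w [j] * grad_Lmin i x w)
        + x $ j * (\<Sum>k\<in>UNIV. w [k, i] * grad_Lmin k x w) - x $ i * (\<Sum>k\<in>UNIV. w [k, j] * grad_Lmin k x w)"
    by (simp add: evder_Lmin phi3_def[abs_def] totD_rules elementary_intros distrib_right
        left_diff_distrib sum.distrib sum_subtractf sum_distrib_left mult.assoc)
  also have "w [i] * grad_Lmin j x w - w [j] * grad_Lmin i x w = 0"
    by (simp add: grad_Lmin_def)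
  finally show ?thesis
    using assms by (simp add: totD_Lmin symjet_swap)
qed

lemma totD_phi4: "totD 1 k phi4 x w = - (\<Sum>c\<in>UNIV. x $ c * w [k, c])"
  by (simp add: phi4_def[abs_def] totD_rules elementary_intros sum.distrib)

lemma evder_phi4:
  assumes "symjet w"
  shows "evder 1 phi4 1 Lmin x w = - (\<Sum>c\<in>UNIV. x $ c * totD 1 c Lmin x w)"
proof -
  have "evder 1 phi4 1 Lmin x w = - (\<Sum>k\<in>UNIV. \<Sum>c\<in>UNIV. x $ c * w [k, c] * grad_Lmin k x w)"
    by (simp add: evder_Lmin totD_phi4 sum_distrib_right sum_negf)
  also have "\<dots> = - (\<Sum>c\<in>UNIV. \<Sum>k\<in>UNIV. x $ c * w [c, k] * grad_Lmin k x w)"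
    using assms by (subst sum.swap) (simp add: symjet_swap)
  finally show ?thesis
    by (simp add: totD_Lmin sum_distrib_left mult.assoc)
qed

lemma noether_phi1: "total_div_on A (evder 0 phi1 1 Lmin)"
  by (rule total_div_onI[where P = "\<lambda>k x w. 0" and m = 0])
    (simp_all add: evder_phi1 elementary_const order_le_def)

lemma noether_phi2: "total_div_on Jinf (evder 1 (phi2 (i::'n::finite)) 1 Lmin)"
proof (rule total_div_onI[where P = "\<lambda>k x w. of_bool (k = i) * Lmin x w"])
  fix x :: "real^'n" and w
  assume "Jinf x w"
  then show "evder 1 (phi2 i) 1 Lmin x w = (\<Sum>k\<in>UNIV. totD 1 k (\<lambda>x w. of_bool (k = i) * Lmin x w) x w)"
    by (simp add: Jinf_def evder_phi2 totD_mult elementary_Lmin elementary_const)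
qed (intro elementary_intros elementary_Lmin, rule order_le_coord_mult_Lmin)

lemma noether_phi3: "total_div_on Jinf (evder 1 (phi3 i (j::'n::finite)) 1 Lmin)"
proof (rule total_div_onI[where P = "\<lambda>k x w. (of_bool (k = i) * x $ j - of_bool (k = j) * x $ i) * Lmin x w"])
  fix x :: "real^'n" and w
  assume "Jinf x w"
  then show "evder 1 (phi3 i j) 1 Lmin x w
      = (\<Sum>k\<in>UNIV. totD 1 k (\<lambda>x w. (of_bool (k = i) * x $ j - of_bool (k = j) * x $ i) * Lmin x w) x w)"
    by (simp add: Jinf_def evder_phi3 totD_rules elementary_Lmin elementary_intros
        left_diff_distrib sum_subtractf mult.assoc)
qed (intro elementary_intros elementary_Lmin, rule order_le_coord_mult_Lmin)

lemma divergence_phi4: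
  "total_div_on (Jinf :: real^'n::finite \<Rightarrow> _) (\<lambda>x w. evder 1 phi4 1 Lmin x w - real CARD('n) * Lmin x w)"
proof (rule total_div_onI[where P = "\<lambda>k x w. - x $ k * Lmin x w"])
  fix x :: "real^'n" and w
  assume "Jinf x w"
  then show "evder 1 phi4 1 Lmin x w - real CARD('n) * Lmin x w
      = (\<Sum>k\<in>UNIV. totD 1 k (\<lambda>x w. - x $ k * Lmin x w) x w)"
    by (simp add: Jinf_def evder_phi4 totD_rules elementary_Lmin elementary_intros sum_subtractf sum_negf)
qed (intro elementary_intros elementary_Lmin, rule order_le_coord_mult_Lmin)

section \<open>Conservation laws\<close>

lemma Einf_imp_symjet: "Einf x w \<Longrightarrow> symjet w"
  by (simp add: Einf_def)

lemma Einf_imp_Jinf: "Einf x w \<Longrightarrow> Jinf x w"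
  by (simp add: Einf_def Jinf_def)

lemma Einf_imp_EL_Lmin: "Einf x w \<Longrightarrow> EL 1 Lmin x w = 0"
  unfolding Einf_def by (metis totDs.simps(1))

lemma conservation_phi1: "(\<Sum>i\<in>UNIV. totD 1 i (wpd [i] Lmin) x w) = - EL 1 Lmin x w"
  by (simp add: EL_Lmin wpd_Lmin_single)

lemma conservation_phi2:
  assumes "symjet w"
  shows "totD 1 i (\<lambda>x w. w [i] * wpd [i] Lmin x w - Lmin x w) x w
      + (\<Sum>j\<in>UNIV - {i}. totD 1 j (\<lambda>x w. w [i] * wpd [j] Lmin x w) x w)
    = - phi2 i x w * EL 1 Lmin x w"
proof -
  let ?J = "\<lambda>j. totD 1 j (\<lambda>x w. w [i] * grad_Lmin j x w) x w"
  have "totD 1 i (\<lambda>x w. w [i] * wpd [i] Lmin x w - Lmin x w) x w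
      + (\<Sum>j\<in>UNIV - {i}. totD 1 j (\<lambda>x w. w [i] * wpd [j] Lmin x w) x w)
    = (\<Sum>j\<in>UNIV. ?J j) - totD 1 i Lmin x w"
    by (simp add: wpd_Lmin_single totD_diff elementary_intros elementary_grad_Lmin
        elementary_Lmin sum.remove)
  also have "(\<Sum>j\<in>UNIV. ?J j) = totD 1 i Lmin x w - w [i] * EL 1 Lmin x w"
    using sum_totD_mult_grad_Lmin[of "\<lambda>x w. w [i]"] assms
    by (simp add: elementary_jet totD_Lmin symjet_swap)
  finally show ?thesis
    by (simp add: phi2_def)
qed

lemma conservation_phi3:
  assumes "symjet w"
  shows "totD 1 i (\<lambda>x w. x $ j * Lmin x w - phi3 i j x w * w [i] / Lmin x w) x w
      - totD 1 j (\<lambda>x w. x $ i * Lmin x w + phi3 i j x w * w [j] / Lmin x w) x w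
      - (\<Sum>k\<in>UNIV - {i, j}. totD 1 k (\<lambda>x w. phi3 i j x w * w [k] / Lmin x w) x w)
    = phi3 i j x w * EL 1 Lmin x w"
proof (cases "i = j")
  case True
  then have "phi3 i j = (\<lambda>x w. 0)"
    by (simp add: phi3_def[abs_def])
  with True show ?thesis
    by (simp add: totD_rules elementary_intros elementary_Lmin)
next
  case False
  let ?F = "\<lambda>k. totD 1 k (\<lambda>x w. phi3 i j x w * grad_Lmin k x w) x w"
  have current: "(\<lambda>x w. phi3 i j x w * w [k] / Lmin x w) = (\<lambda>x w. phi3 i j x w * grad_Lmin k x w)" for k
    by (simp add: grad_Lmin_def)
  have "(\<Sum>k\<in>UNIV. ?F k) = ?F i + ?F j + (\<Sum>k\<in>UNIV - {i, j}. ?F k)"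
    using False by (simp add: sum_remove2)
  then have "totD 1 i (\<lambda>x w. x $ j * Lmin x w - phi3 i j x w * w [i] / Lmin x w) x w
      - totD 1 j (\<lambda>x w. x $ i * Lmin x w + phi3 i j x w * w [j] / Lmin x w) x w
      - (\<Sum>k\<in>UNIV - {i, j}. totD 1 k (\<lambda>x w. phi3 i j x w * w [k] / Lmin x w) x w)
    = x $ j * totD 1 i Lmin x w - x $ i * totD 1 j Lmin x w - (\<Sum>k\<in>UNIV. ?F k)"
    using False by (simp add: current totD_rules elementary_intros elementary_Lmin
        elementary_phi3 elementary_grad_Lmin)
  also have "(\<Sum>k\<in>UNIV. ?F k) = evder 1 (phi3 i j) 1 Lmin x w - phi3 i j x w * EL 1 Lmin x w"
    using sum_totD_mult_grad_Lmin[OF elementary_phi3] by (simp add: evder_Lmin)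
  finally show ?thesis
    using evder_phi3[OF assms] by simp
qed

lemma deriv_shift_nonlocal: "deriv (\<lambda>t. (s(k := s k + t)) i + c) 0 = of_bool (k = i)"
  for s :: "'a \<Rightarrow> real"
proof (cases "k = i")
  case True
  have "((\<lambda>t. s i + t + c) has_real_derivative 1) (at 0)"
    by (auto intro!: derivative_eq_intros)
  with True show ?thesis
    by (simp add: DERIV_imp_deriv)
qed simp

lemma tDc_dilation_current:
  fixes S :: "'n::finite \<Rightarrow> 'n \<Rightarrow> 'n dfun"
  assumes "S i i = Lmin"
  shows "tDc 1 S i
      (\<lambda>x w s. s i - x $ i * Lmin x w
         - w [] * w [i] / sqrt (1 + (\<Sum>j\<in>UNIV. (w [j])\<^sup>2))
         + w [i] * (\<Sum>j\<in>UNIV. x $ j * w [j]) / sqrt (1 + (\<Sum>k\<in>UNIV. (w [k])\<^sup>2))) x w s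
    = - x $ i * totD 1 i Lmin x w + totD 1 i (\<lambda>x w. - phi4 x w * grad_Lmin i x w) x w"
proof -
  have current: "(\<lambda>x w s. s i - x $ i * Lmin x w
         - w [] * w [i] / sqrt (1 + (\<Sum>j\<in>UNIV. (w [j])\<^sup>2))
         + w [i] * (\<Sum>j\<in>UNIV. x $ j * w [j]) / sqrt (1 + (\<Sum>k\<in>UNIV. (w [k])\<^sup>2)))
      = (\<lambda>x w s. s i + (- x $ i * Lmin x w + - phi4 x w * grad_Lmin i x w))"
    by (intro ext) (simp add: Lmin_def grad_Lmin_def phi4_def diff_divide_distrib ring_distribs)
  have "totD 1 i (\<lambda>x w. s i + (- x $ i * Lmin x w + - phi4 x w * grad_Lmin i x w)) x w
      = - Lmin x w - x $ i * totD 1 i Lmin x w + totD 1 i (\<lambda>x w. - phi4 x w * grad_Lmin i x w) x w"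
    by (simp add: totD_rules elementary_intros elementary_Lmin elementary_phi4 elementary_grad_Lmin)
  moreover have "(\<Sum>k\<in>UNIV. S i k x w * of_bool (k = i)) = Lmin x w"
    using assms by simp
  ultimately show ?thesis
    unfolding tDc_def current deriv_shift_nonlocal by simp
qed

lemma conservation_phi4_nonlocal:
  fixes S :: "'n::finite \<Rightarrow> 'n \<Rightarrow> 'n dfun"
  assumes "\<And>i. S i i = Lmin" and "symjet w"
  shows "(\<Sum>i\<in>UNIV. tDc 1 S i
      (\<lambda>x w s. s i - x $ i * Lmin x w
         - w [] * w [i] / sqrt (1 + (\<Sum>j\<in>UNIV. (w [j])\<^sup>2))
         + w [i] * (\<Sum>j\<in>UNIV. x $ j * w [j]) / sqrt (1 + (\<Sum>k\<in>UNIV. (w [k])\<^sup>2))) x w s)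
    = phi4 x w * EL 1 Lmin x w"
proof -
  have "(\<Sum>i\<in>UNIV. totD 1 i (\<lambda>x w. - phi4 x w * grad_Lmin i x w) x w)
      = - evder 1 phi4 1 Lmin x w + phi4 x w * EL 1 Lmin x w"
    using sum_totD_mult_grad_Lmin[of "\<lambda>x w. - phi4 x w"]
    by (simp add: elementary_minus elementary_phi4 totD_minus evder_Lmin sum_negf)
  then show ?thesis
    using assms by (simp add: tDc_dilation_current sum_subtractf evder_phi4)
qed

section \<open>The Euler--Lagrange operator on the dilatation\<close>

lemma evder_phi4_eq:
  "evder 1 phi4 1 Lmin = (\<lambda>x w. - (\<Sum>k\<in>UNIV. (\<Sum>c\<in>UNIV. x $ c * w [k, c]) * grad_Lmin k x w))"
  by (intro ext) (simp add: evder_Lmin totD_phi4 sum_negf)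

lemma dirderiv_evder_phi4:
  "dirderiv v d (evder 1 phi4 1 Lmin) x w
    = - (\<Sum>k\<in>UNIV. (\<Sum>c\<in>UNIV. v $ c * w [k, c] + x $ c * d [k, c]) * grad_Lmin k x w
          + (\<Sum>c\<in>UNIV. x $ c * w [k, c]) * (\<Sum>e\<in>UNIV. d [e] * hess_Lmin k e x w))"
  by (simp add: evder_phi4_eq dirderiv_minus dirderiv_sum dirderiv_mult dirderiv_grad_Lmin
      elementary_intros elementary_grad_Lmin)

lemma wpd_Nil_evder_phi4: "wpd [] (evder 1 phi4 1 Lmin) = (\<lambda>x w. 0)"
  by (intro ext) (simp add: wpd_eq_dirderiv dirderiv_evder_phi4)

lemma wpd_single_evder_phi4:
  "wpd [b] (evder 1 phi4 1 Lmin) = (\<lambda>x w. - (\<Sum>k\<in>UNIV. (\<Sum>c\<in>UNIV. x $ c * w [k, c]) * hess_Lmin k b x w))"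
  by (intro ext) (simp add: wpd_eq_dirderiv dirderiv_evder_phi4 mult.commute)

lemma wpd_pair_evder_phi4:
  "wpd [a, b] (evder 1 phi4 1 Lmin) = (\<lambda>x w. - x $ b * grad_Lmin a x w)"
proof (intro ext)
  fix x :: "real^'a" and w
  have "(\<Sum>c\<in>UNIV. x $ c * of_bool ([k, c] = [a, b])) = of_bool (k = a) * x $ b" for k
    by (cases "k = a") simp_all
  then show "wpd [a, b] (evder 1 phi4 1 Lmin) x w = - x $ b * grad_Lmin a x w"
    by (simp add: wpd_eq_dirderiv dirderiv_evder_phi4 mult.assoc)
qed

lemma totD_wpd_single_evder_phi4:
  "totD 2 b (wpd [b] (evder 1 phi4 1 Lmin)) x w
    = - (\<Sum>k\<in>UNIV. (w [k, b] + (\<Sum>c\<in>UNIV. x $ c * w [b, k, c])) * hess_Lmin k b x w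
          + (\<Sum>c\<in>UNIV. x $ c * w [k, c]) * totD 1 b (hess_Lmin k b) x w)"
  by (simp add: wpd_single_evder_phi4 totD_rules elementary_intros elementary_hess_Lmin
      totD_order_le[OF order_le_hess_Lmin, of 2] sum.distrib)

lemma totD_totD_wpd_pair_evder_phi4:
  "totD 3 a (totD 2 b (wpd [a, b] (evder 1 phi4 1 Lmin))) x w
    = - (\<Sum>c\<in>UNIV. w [a, c] * hess_Lmin a c x w)
      - of_bool (a = b) * (\<Sum>c\<in>UNIV. w [b, c] * hess_Lmin a c x w)
      - x $ b * (\<Sum>c\<in>UNIV. w [a, b, c] * hess_Lmin a c x w + w [b, c] * totD 1 a (hess_Lmin a c) x w)"
proof -
  have "totD 2 b (wpd [a, b] (evder 1 phi4 1 Lmin))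
      = (\<lambda>x w. - grad_Lmin a x w - x $ b * (\<Sum>c\<in>UNIV. w [b, c] * hess_Lmin a c x w))"
    by (intro ext) (simp add: wpd_pair_evder_phi4 totD_mult totD_minus elementary_intros
        elementary_grad_Lmin totD_grad_Lmin)
  then show ?thesis
    by (simp add: totD_rules elementary_intros elementary_grad_Lmin elementary_hess_Lmin
        totD_grad_Lmin totD_order_le[OF order_le_hess_Lmin, of 3] sum.distrib)
qed

lemma sum_totD_wpd_single_evder_phi4:
  assumes "symjet w"
  shows "(\<Sum>b\<in>UNIV. totD 2 b (wpd [b] (evder 1 phi4 1 Lmin)) x w)
    = - (\<Sum>a\<in>UNIV. \<Sum>c\<in>UNIV. w [a, c] * hess_Lmin a c x w)
      - (\<Sum>a\<in>UNIV. \<Sum>b\<in>UNIV. \<Sum>c\<in>UNIV. x $ b * w [a, b, c] * hess_Lmin a c x w)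
      - (\<Sum>a\<in>UNIV. \<Sum>b\<in>UNIV. \<Sum>c\<in>UNIV. x $ b * w [b, c] * totD 1 a (hess_Lmin a c) x w)"
proof -
  have hess_term: "(\<Sum>b\<in>UNIV. \<Sum>k\<in>UNIV. w [k, b] * hess_Lmin k b x w)
      = (\<Sum>a\<in>UNIV. \<Sum>c\<in>UNIV. w [a, c] * hess_Lmin a c x w)"
    by (rule sum.swap)
  have "(\<Sum>b\<in>UNIV. \<Sum>k\<in>UNIV. (\<Sum>c\<in>UNIV. x $ c * w [b, k, c]) * hess_Lmin k b x w)
      = (\<Sum>k\<in>UNIV. \<Sum>b\<in>UNIV. \<Sum>c\<in>UNIV. x $ c * w [b, k, c] * hess_Lmin k b x w)"
    unfolding sum_distrib_right by (rule sum.swap)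
  also have "\<dots> = (\<Sum>k\<in>UNIV. \<Sum>c\<in>UNIV. \<Sum>b\<in>UNIV. x $ c * w [b, k, c] * hess_Lmin k b x w)"
    by (rule sum.cong[OF refl], rule sum.swap)
  also have "\<dots> = (\<Sum>a\<in>UNIV. \<Sum>b\<in>UNIV. \<Sum>c\<in>UNIV. x $ b * w [a, b, c] * hess_Lmin a c x w)"
    by (intro sum.cong refl) (use assms in \<open>simp add: symjet_swap_head symjet_swap_tail\<close>)
  finally have third_jet_term: "(\<Sum>b\<in>UNIV. \<Sum>k\<in>UNIV. (\<Sum>c\<in>UNIV. x $ c * w [b, k, c]) * hess_Lmin k b x w)
      = (\<Sum>a\<in>UNIV. \<Sum>b\<in>UNIV. \<Sum>c\<in>UNIV. x $ b * w [a, b, c] * hess_Lmin a c x w)" .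
  have "(\<Sum>b\<in>UNIV. \<Sum>k\<in>UNIV. (\<Sum>c\<in>UNIV. x $ c * w [k, c]) * totD 1 b (hess_Lmin k b) x w)
      = (\<Sum>b\<in>UNIV. \<Sum>c\<in>UNIV. \<Sum>k\<in>UNIV. x $ c * w [k, c] * totD 1 b (hess_Lmin k b) x w)"
    unfolding sum_distrib_right by (rule sum.cong[OF refl], rule sum.swap)
  also have "\<dots> = (\<Sum>a\<in>UNIV. \<Sum>b\<in>UNIV. \<Sum>c\<in>UNIV. x $ b * w [b, c] * totD 1 a (hess_Lmin a c) x w)"
    by (intro sum.cong refl) (use assms in \<open>simp add: symjet_swap hess_Lmin_sym\<close>)
  finally have dhess_term: "(\<Sum>b\<in>UNIV. \<Sum>k\<in>UNIV. (\<Sum>c\<in>UNIV. x $ c * w [k, c]) * totD 1 b (hess_Lmin k b) x w)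
      = (\<Sum>a\<in>UNIV. \<Sum>b\<in>UNIV. \<Sum>c\<in>UNIV. x $ b * w [b, c] * totD 1 a (hess_Lmin a c) x w)" .
  show ?thesis
    unfolding totD_wpd_single_evder_phi4 sum_negf distrib_right sum.distrib
    by (simp add: sum_negf hess_term third_jet_term dhess_term)
qed

lemma sum_totD_totD_wpd_pair_evder_phi4:
  fixes x :: "real^'n::finite" and w :: "'n list \<Rightarrow> real"
  shows "(\<Sum>a\<in>UNIV. \<Sum>b\<in>UNIV. totD 3 a (totD 2 b (wpd [a, b] (evder 1 phi4 1 Lmin))) x w)
    = real CARD('n) * EL 1 Lmin x w
      - (\<Sum>a\<in>UNIV. \<Sum>c\<in>UNIV. w [a, c] * hess_Lmin a c x w)
      - (\<Sum>a\<in>UNIV. \<Sum>b\<in>UNIV. \<Sum>c\<in>UNIV. x $ b * w [a, b, c] * hess_Lmin a c x w)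
      - (\<Sum>a\<in>UNIV. \<Sum>b\<in>UNIV. \<Sum>c\<in>UNIV. x $ b * w [b, c] * totD 1 a (hess_Lmin a c) x w)"
proof -
  have diagonal: "(\<Sum>a\<in>UNIV. \<Sum>b\<in>UNIV. of_bool (a = b) * (\<Sum>c\<in>UNIV. w [b, c] * hess_Lmin a c x w))
      = (\<Sum>a\<in>UNIV. \<Sum>c\<in>UNIV. w [a, c] * hess_Lmin a c x w)"
    by simp
  have "(\<Sum>a\<in>UNIV. \<Sum>b\<in>UNIV. totD 3 a (totD 2 b (wpd [a, b] (evder 1 phi4 1 Lmin))) x w)
    = - (\<Sum>a\<in>UNIV. \<Sum>b::'n\<in>UNIV. \<Sum>c\<in>UNIV. w [a, c] * hess_Lmin a c x w)
      - (\<Sum>a\<in>UNIV. \<Sum>c\<in>UNIV. w [a, c] * hess_Lmin a c x w)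
      - (\<Sum>a\<in>UNIV. \<Sum>b\<in>UNIV. x $ b * (\<Sum>c\<in>UNIV. w [a, b, c] * hess_Lmin a c x w
          + w [b, c] * totD 1 a (hess_Lmin a c) x w))"
    unfolding diagonal[symmetric]
    by (simp add: totD_totD_wpd_pair_evder_phi4 sum_subtractf sum_negf del: sum_of_bool_mult_eq)
  moreover have "EL 1 Lmin x w = - (\<Sum>a\<in>UNIV. \<Sum>c\<in>UNIV. w [a, c] * hess_Lmin a c x w)"
    by (simp add: EL_Lmin totD_grad_Lmin)
  ultimately show ?thesis
    by (simp add: sum_distrib_left distrib_left sum.distrib mult.assoc)
qed

lemma EL_evder_phi4:
  fixes x :: "real^'n::finite" and w :: "'n list \<Rightarrow> real"
  assumes "symjet w"
  shows "EL 2 (evder 1 phi4 1 Lmin) x w = real CARD('n) * EL 1 Lmin x w"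
proof -
  have "EL 2 (evder 1 phi4 1 Lmin) x w
      = - (\<Sum>b\<in>UNIV. totD 2 b (wpd [b] (evder 1 phi4 1 Lmin)) x w)
        + (\<Sum>a\<in>UNIV. \<Sum>b\<in>UNIV. totD 3 a (totD 2 b (wpd [a, b] (evder 1 phi4 1 Lmin))) x w)"
    by (simp add: EL_def sum_lists_le_2 wpd_Nil_evder_phi4 sum_negf)
  then show ?thesis
    by (simp add: sum_totD_wpd_single_evder_phi4[OF assms] sum_totD_totD_wpd_pair_evder_phi4)
qed

theorem proposition4:
  fixes n :: nat
  assumes "n = CARD('n::finite)"
  shows
   "total_div_on (Jinf :: real^'n \<Rightarrow> _) (evder 0 phi1 1 Lmin)
    \<and> (\<forall>i::'n. total_div_on Jinf (evder 1 (phi2 i) 1 Lmin))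
    \<and> (\<forall>i j::'n. total_div_on Jinf (evder 1 (phi3 i j) 1 Lmin))
    \<and> (\<forall>x (w :: 'n list \<Rightarrow> real). Einf x w \<longrightarrow>
         (\<Sum>i\<in>UNIV. totD 1 i (wpd [i] Lmin) x w) = 0)
    \<and> (\<forall>(i::'n) x w. Einf x w \<longrightarrow>
         totD 1 i (\<lambda>x w. w [i] * wpd [i] Lmin x w - Lmin x w) x w
         + (\<Sum>j\<in>UNIV - {i}. totD 1 j (\<lambda>x w. w [i] * wpd [j] Lmin x w) x w) = 0)
    \<and> (\<forall>(i::'n) j x w. Einf x w \<longrightarrow>
         totD 1 i (\<lambda>x w. x $ j * Lmin x w - phi3 i j x w * w [i] / Lmin x w) x w
         - totD 1 j (\<lambda>x w. x $ i * Lmin x w + phi3 i j x w * w [j] / Lmin x w) x w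
         - (\<Sum>k\<in>UNIV - {i, j}. totD 1 k (\<lambda>x w. phi3 i j x w * w [k] / Lmin x w) x w) = 0)
    \<and> total_div_on (Einf :: real^'n \<Rightarrow> _)
         (\<lambda>x w. evder 1 phi4 1 Lmin x w - real n * Lmin x w)
    \<and> (\<forall>x (w :: 'n list \<Rightarrow> real). Einf x w \<longrightarrow>
         EL 2 (evder 1 phi4 1 Lmin) x w = real n * EL 1 Lmin x w
         \<and> EL 1 Lmin x w = 0)
    \<and> (\<forall>S :: 'n \<Rightarrow> 'n \<Rightarrow> 'n dfun. (\<forall>i. S i i = Lmin) \<longrightarrow>
         (\<forall>x w s. Einf x w \<longrightarrow>
           (\<Sum>i\<in>UNIV. tDc 1 S i
              (\<lambda>x w s. s i - x $ i * Lmin x w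
                 - w [] * w [i] / sqrt (1 + (\<Sum>j\<in>UNIV. (w [j])\<^sup>2))
                 + w [i] * (\<Sum>j\<in>UNIV. x $ j * w [j]) / sqrt (1 + (\<Sum>k\<in>UNIV. (w [k])\<^sup>2)))
              x w s) = 0))"
proof -
  have on_Einf: "symjet w" "EL 1 Lmin x w = 0" if "Einf x w" for x :: "real^'n" and w
    using that by (simp_all add: Einf_imp_symjet Einf_imp_EL_Lmin)
  show ?thesis
    unfolding assms
    by (simp add: noether_phi1 noether_phi2 noether_phi3 conservation_phi1 conservation_phi2
        conservation_phi3 conservation_phi4_nonlocal EL_evder_phi4 on_Einf
        total_div_on_mono[OF divergence_phi4 Einf_imp_Jinf])
qed

end
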